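(* If $G$ is a regular $\omega$-narrow first-countable paratopological group, then $G$ condenses onto a second-countable Hausdorff space.
   Context: All spaces are $T_0$ (so a regular space is Hausdorff). A paratopological group is a group $G$ with a topology such that the product map $G\times G\to G$ is jointly continuous. $G$ is $\omega$-narrow if for each neighborhood $U$ of the neutral element of $G$ there is a countable subset $F$ of $G$ such that $G\subset FU\cap UF$. A space $X$ condenses onto a space $Y$ if there is a continuous bijection from $X$ onto $Y$. *)

theory Defs
  imports "HOL-Analysis.Analysis" "HOL-Algebra.Coset"
begin

locale paratopological_group = group G for G (structure) +
  fixes T :: "'a topology"
  assumes topspace_eq_carrier: "topspace T = carrier G"
    and continuous_mult: "continuous_map (prod_topology T T) T (\<lambda>(x, y). x \<otimes> y)"

(* Neighborhoods need not be open. *)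
definition neighborhood_of :: "'a topology \<Rightarrow> 'a \<Rightarrow> 'a set \<Rightarrow> bool" where
  "neighborhood_of T x U \<longleftrightarrow> U \<subseteq> topspace T \<and> (\<exists>W. openin T W \<and> x \<in> W \<and> W \<subseteq> U)"

definition omega_narrow :: "('a, 'm) monoid_scheme \<Rightarrow> 'a topology \<Rightarrow> bool" where
  "omega_narrow G T \<longleftrightarrow>
     (\<forall>U. neighborhood_of T \<one>\<^bsub>G\<^esub> U \<longrightarrow>
        (\<exists>F. F \<subseteq> carrier G \<and> countable F \<and>
             carrier G \<subseteq> (F <#>\<^bsub>G\<^esub> U) \<inter> (U <#>\<^bsub>G\<^esub> F)))"

definition condenses_onto :: "'a topology \<Rightarrow> 'b topology \<Rightarrow> bool" where
  "condenses_onto X Y \<longleftrightarrow>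
     (\<exists>f. continuous_map X Y f \<and> bij_betw f (topspace X) (topspace Y))"

end

theory Submission
  imports Defs
begin

text \<open>If \<open>x \<noteq> y\<close>, the Hausdorff property gives a neighborhood \<open>U\<close> of the identity
  with \<open>x y\<^sup>-\<^sup>1 \<notin> U U\<^sup>-\<^sup>1\<close>, so no right translate of \<open>U\<close> contains both points. Take \<open>B\<close>
  in a countable base at the identity with closure inside \<open>U\<close>, and \<open>f\<close> in the countable set
  attached to \<open>B\<close> by narrowness with \<open>x \<in> B f\<close>. Then \<open>B f\<close> and the complement of the closed
  set \<open>cl(B) f\<close> separate \<open>x\<close> from \<open>y\<close>, and only countably many such sets arise. They generate
  the coarser topology.\<close>

text \<open>Finite intersections of generators form a base, by induction on how an open set is
  generated. The families \<open>F\<close> are nonempty because \<open>\<Inter>{}\<close> is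
  \<open>UNIV\<close>, which need not be open.\<close>

lemma second_countable_generated:
  assumes "countable S"
  shows "second_countable (topology_generated_by S)"
  unfolding second_countable_def
proof (intro exI conjI allI impI ballI)
  let ?B = "Inter ` {F. finite F \<and> F \<subseteq> S \<and> F \<noteq> {}}"
  have "countable {F. finite F \<and> F \<subseteq> S}"
    using assms by (rule countable_Collect_finite_subset)
  then show "countable ?B"
    by (intro countable_image) (rule countable_subset[rotated], auto)
  show "openin (topology_generated_by S) V" if "V \<in> ?B" for V
    using that by (auto intro!: openin_Inter intro: topology_generated_by_Basis)
  fix U x
  assume "openin (topology_generated_by S) U \<and> x \<in> U"
  then have "generate_topology_on S U" and "x \<in> U"
    by (auto simp: openin_topology_generated_by_iff)
  then show "\<exists>V\<in>?B. x \<in> V \<and> V \<subseteq> U"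
  proof (induction arbitrary: x)
    case Empty
    then show ?case by simp
  next
    case (Int a b)
    then have "x \<in> a" and "x \<in> b"
      by auto
    obtain F where "finite F" "F \<subseteq> S" "F \<noteq> {}" "x \<in> \<Inter>F" "\<Inter>F \<subseteq> a"
      using Int.IH(1)[OF \<open>x \<in> a\<close>] by blast
    moreover obtain F' where "finite F'" "F' \<subseteq> S" "F' \<noteq> {}" "x \<in> \<Inter>F'" "\<Inter>F' \<subseteq> b"
      using Int.IH(2)[OF \<open>x \<in> b\<close>] by blast
    ultimately show ?case
      by (intro bexI[of _ "\<Inter>(F \<union> F')"] image_eqI[OF refl]) auto
  next
    case (UN K)
    then obtain k where "k \<in> K" "x \<in> k" by blast
    with UN.IH show ?case by (meson Union_upper order_trans)
  next
    case (Basis s)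
    then show ?case
      by (intro bexI[of _ "\<Inter>{s}"] image_eqI[OF refl]) auto
  qed
qed

lemma (in paratopological_group) continuous_map_left_translation:
  assumes "a \<in> carrier G"
  shows "continuous_map T T (\<lambda>t. a \<otimes> t)"
proof -
  have "continuous_map T (prod_topology T T) (\<lambda>t. (a, t))"
    using assms by (simp add: continuous_map_pairwise o_def topspace_eq_carrier)
  from continuous_map_compose[OF this continuous_mult] show ?thesis by (simp add: o_def)
qed

lemma (in paratopological_group) continuous_map_right_translation:
  assumes "a \<in> carrier G"
  shows "continuous_map T T (\<lambda>t. t \<otimes> a)"
proof -
  have "continuous_map T (prod_topology T T) (\<lambda>t. (t, a))"
    using assms by (simp add: continuous_map_pairwise o_def topspace_eq_carrier)
  from continuous_map_compose[OF this continuous_mult] show ?thesis by (simp add: o_def)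
qed

text \<open>As a preimage under right translation by \<open>inv a\<close>, a translate of an open or
  closed set is again open or closed. Only translations have to be continuous, not
  inversion.\<close>

lemma (in group) r_coset_eq_vimage:
  assumes "A \<subseteq> carrier G" and "a \<in> carrier G"
  shows "A #> a = {t \<in> carrier G. t \<otimes> inv a \<in> A}"
proof (intro Set.set_eqI iffI)
  fix t assume "t \<in> A #> a"
  then show "t \<in> {t \<in> carrier G. t \<otimes> inv a \<in> A}"
    using assms by (auto simp: r_coset_def m_assoc subset_iff)
next
  fix t assume t: "t \<in> {t \<in> carrier G. t \<otimes> inv a \<in> A}"
  then have "t = (t \<otimes> inv a) \<otimes> a"
    using assms by (simp add: m_assoc)
  with t show "t \<in> A #> a"
    unfolding r_coset_def by blast
qed

lemma (in paratopological_group) openin_r_coset: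
  assumes "openin T A" and "a \<in> carrier G"
  shows "openin T (A #> a)"
  using openin_continuous_map_preimage[OF continuous_map_right_translation assms(1), of "inv a"]
    openin_subset[OF assms(1)] assms(2)
  by (simp add: r_coset_eq_vimage topspace_eq_carrier)

lemma (in paratopological_group) closedin_r_coset:
  assumes "closedin T A" and "a \<in> carrier G"
  shows "closedin T (A #> a)"
  using closedin_continuous_map_preimage[OF continuous_map_right_translation assms(1), of "inv a"]
    closedin_subset[OF assms(1)] assms(2)
  by (simp add: r_coset_eq_vimage topspace_eq_carrier)

text \<open>Separate the identity from \<open>z\<close> by \<open>V\<close> and \<open>W\<close>,
  and shrink \<open>V\<close> so that left translation by \<open>z\<close> carries it into
  \<open>W\<close>. The conclusion says that \<open>z\<close> is not a quotient of two elements of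
  \<open>U\<close>.\<close>

lemma (in paratopological_group) disjoint_neighborhood_of_one:
  assumes "Hausdorff_space T" and "z \<in> carrier G" and "z \<noteq> \<one>"
  obtains U where "openin T U" and "\<one> \<in> U" and "\<And>u. u \<in> U \<Longrightarrow> z \<otimes> u \<notin> U"
proof -
  obtain V W where VW: "openin T V" "openin T W" "\<one> \<in> V" "z \<in> W" "disjnt V W"
    using assms unfolding Hausdorff_space_def topspace_eq_carrier by (metis one_closed)
  define U where "U = V \<inter> {u \<in> topspace T. z \<otimes> u \<in> W}"
  show thesis
  proof
    show "openin T U"
      unfolding U_def using VW assms(2)
      by (intro openin_Int openin_continuous_map_preimage[OF continuous_map_left_translation])
    show "\<one> \<in> U"
      using VW assms(2) by (simp add: U_def topspace_eq_carrier)
    show "z \<otimes> u \<notin> U" if "u \<in> U" for u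
      using that VW(5) by (auto simp: U_def disjnt_iff)
  qed
qed

lemma (in paratopological_group) countable_separating_family:
  assumes "Hausdorff_space T" and "regular_space T"
    and "omega_narrow G T" and "first_countable T"
  obtains S where "countable S" and "\<And>V. V \<in> S \<Longrightarrow> openin T V"
    and "\<And>x y. \<lbrakk>x \<in> carrier G; y \<in> carrier G; x \<noteq> y\<rbrakk>
          \<Longrightarrow> \<exists>V\<in>S. \<exists>W\<in>S. x \<in> V \<and> y \<in> W \<and> disjnt V W"
proof -
  obtain \<B> where \<B>: "countable \<B>" "\<And>B. B \<in> \<B> \<Longrightarrow> openin T B"
    and base: "\<And>U. \<lbrakk>openin T U; \<one> \<in> U\<rbrakk> \<Longrightarrow> \<exists>B\<in>\<B>. \<one> \<in> B \<and> B \<subseteq> U"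
    using assms(4) unfolding first_countable_def topspace_eq_carrier by (metis one_closed)
  \<comment> \<open>Members of \<open>\<B>\<close> may miss the identity; narrowness applies only to
    those that contain it.\<close>
  define \<B>1 where "\<B>1 = {B \<in> \<B>. \<one> \<in> B}"
  have "\<forall>B\<in>\<B>1. \<exists>F. F \<subseteq> carrier G \<and> countable F \<and> carrier G \<subseteq> B <#> F"
  proof
    fix B assume "B \<in> \<B>1"
    then have "neighborhood_of T \<one> B"
      using \<B>(2) openin_subset by (auto simp: \<B>1_def neighborhood_of_def)
    with assms(3) obtain F where "F \<subseteq> carrier G" "countable F" "carrier G \<subseteq> (F <#> B) \<inter> (B <#> F)"
      unfolding omega_narrow_def by meson
    then show "\<exists>F. F \<subseteq> carrier G \<and> countable F \<and> carrier G \<subseteq> B <#> F"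
      by (intro exI[of _ F]) simp
  qed
  from bchoice[OF this]
  obtain F where "\<forall>B\<in>\<B>1. F B \<subseteq> carrier G \<and> countable (F B) \<and> carrier G \<subseteq> B <#> F B"
    by (rule exE)
  then have F: "\<And>B. B \<in> \<B>1 \<Longrightarrow> F B \<subseteq> carrier G" "\<And>B. B \<in> \<B>1 \<Longrightarrow> countable (F B)"
    "\<And>B. B \<in> \<B>1 \<Longrightarrow> carrier G \<subseteq> B <#> F B"
    by simp_all
  define S where "S = (\<Union>B\<in>\<B>1. \<Union>f\<in>F B. {B #> f, topspace T - ((T closure_of B) #> f)})"
  show thesis
  proof
    show "countable S"
      unfolding S_def using \<B>(1) F(2) by (intro countable_UN) (auto simp: \<B>1_def)
    show "openin T V" if "V \<in> S" for V
      using that F(1) \<B>(2) unfolding S_def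
      by (auto simp: \<B>1_def intro!: openin_r_coset openin_diff closedin_r_coset)
    fix x y assume xy: "x \<in> carrier G" "y \<in> carrier G" "x \<noteq> y"
    have "x \<otimes> inv y \<noteq> \<one>"
      using xy by (metis inv_closed inv_equality inv_inv)
    then obtain U where U: "openin T U" "\<one> \<in> U" "\<And>u. u \<in> U \<Longrightarrow> x \<otimes> inv y \<otimes> u \<notin> U"
      using disjoint_neighborhood_of_one[OF assms(1), of "x \<otimes> inv y"] xy by auto
    \<comment> \<open>Regularity enters as a neighborhood base of closed sets: any \<open>B\<close>
      inside \<open>W\<close> has its closure inside \<open>C\<close>, hence inside
      \<open>U\<close>.\<close>
    obtain W C where WC: "openin T W" "closedin T C" "\<one> \<in> W" "W \<subseteq> C" "C \<subseteq> U"
      using assms(2) U(1,2) unfolding neighbourhood_base_of_closedin[symmetric] neighbourhood_base_of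
      by metis
    obtain B where B: "B \<in> \<B>1" "B \<subseteq> W"
      using base[OF WC(1,3)] by (auto simp: \<B>1_def)
    have clB: "T closure_of B \<subseteq> U"
      using B(2) WC by (meson closure_of_minimal order_trans)
    have B_sub: "B \<subseteq> T closure_of B"
      using B(1) \<B>(2) by (simp add: \<B>1_def closure_of_subset openin_subset)
    have U_sub: "U \<subseteq> carrier G"
      using U(1) openin_subset topspace_eq_carrier by blast
    obtain b f where bf: "b \<in> B" "f \<in> F B" "x = b \<otimes> f"
      using F(3)[OF B(1)] xy(1) by (auto simp: set_mult_def)
    have f: "f \<in> carrier G"
      using F(1) B(1) bf(2) by blast
    have b: "b \<in> U"
      using bf(1) B_sub clB by blast
    have "y \<notin> (T closure_of B) #> f"
    proof
      assume "y \<in> (T closure_of B) #> f"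
      then obtain u where u: "u \<in> U" "y = u \<otimes> f"
        using clB by (auto simp: r_coset_def)
      \<comment> \<open>From \<open>x = b \<otimes> f\<close> and \<open>y = u \<otimes> f\<close>
        the factor \<open>f\<close> cancels in \<open>x \<otimes> inv y\<close>, leaving
        \<open>b \<otimes> inv u\<close>. So \<open>x \<otimes> inv y\<close> would carry
        \<open>u\<close> to \<open>b\<close>, both in \<open>U\<close>, against the choice of
        \<open>U\<close>.\<close>
      have "x \<otimes> inv y \<otimes> u = b"
        using b u f U_sub by (simp add: bf(3) inv_mult_group m_assoc subset_iff)
      then show False
        using U(3)[OF u(1)] b by simp
    qed
    moreover have "x \<in> B #> f"
      using bf by (auto simp: r_coset_def)
    moreover have "B #> f \<subseteq> (T closure_of B) #> f"
      using B_sub by (auto simp: r_coset_def)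
    ultimately show "\<exists>V\<in>S. \<exists>W\<in>S. x \<in> V \<and> y \<in> W \<and> disjnt V W"
      using B(1) bf(2) xy(2)
      by (intro bexI[of _ "B #> f"] bexI[of _ "topspace T - ((T closure_of B) #> f)"])
        (auto simp: S_def topspace_eq_carrier disjnt_iff)
  qed
qed

theorem theorem3p6:
  fixes G :: "('a, 'm) monoid_scheme" and T :: "'a topology"
  assumes "paratopological_group G T"
    and "t0_space T"
    and "regular_space T"
    and "omega_narrow G T"
    and "first_countable T"
  shows "\<exists>Y :: 'a topology. second_countable Y \<and> Hausdorff_space Y \<and> condenses_onto T Y"
proof -
  interpret paratopological_group G T by fact
  have "Hausdorff_space T"
    using assms(2,3) by (rule regular_t0_imp_Hausdorff_space[rotated])
  then obtain S where S: "countable S" "\<And>V. V \<in> S \<Longrightarrow> openin T V"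
    and sep: "\<And>x y. \<lbrakk>x \<in> carrier G; y \<in> carrier G; x \<noteq> y\<rbrakk>
          \<Longrightarrow> \<exists>V\<in>S. \<exists>W\<in>S. x \<in> V \<and> y \<in> W \<and> disjnt V W"
    using countable_separating_family assms(3-5) by metis
  \<comment> \<open>The whole space is added because \<open>S\<close> need not cover the trivial group.\<close>
  let ?S = "insert (topspace T) S"
  let ?Y = "topology_generated_by ?S"
  have topspace: "topspace ?Y = topspace T"
    using S(2)[THEN openin_subset] by auto
  have "second_countable ?Y"
    using S(1) by (intro second_countable_generated) simp
  \<comment> \<open>The separating sets are themselves generators, so they stay open in the coarser
    topology.\<close>
  moreover have "Hausdorff_space ?Y"
    unfolding Hausdorff_space_def topspace
    using sep by (metis topspace_eq_carrier insertCI topology_generated_by_Basis)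
  \<comment> \<open>The condensation is the identity map: every generator is open in
    \<open>T\<close>, and both topologies have the same points.\<close>
  moreover have "continuous_map T ?Y id"
    using S(2) by (intro continuous_on_generated_topo) auto
  then have "condenses_onto T ?Y"
    unfolding condenses_onto_def topspace using bij_betw_id by blast
  ultimately show ?thesis by blast
qed

end
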